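(* Let $\mu \in \mathbb{R}^n$ and $\sigma^2 > 0$ be fixed, and let $y \sim N(\mu, \sigma^2 I)$ in $\mathbb{R}^n$. Let $X \in \mathbb{R}^{n \times p}$ be a fixed matrix with orthonormal columns, i.e. $X^T X = I$, and let $\lambda \ge 0$ be fixed. Let $$\hat\beta^{\mathrm{subset}} \in \mathop{\mathrm{argmin}}_{\beta \in \mathbb{R}^p} \ \frac{1}{2}\|y - X\beta\|_2^2 + \lambda \|\beta\|_0,$$ let $\hat\mu^{\mathrm{subset}} = X \hat\beta^{\mathrm{subset}}$ be the best subset selection fit, and let $\mathcal{A}^{\mathrm{subset}} = \mathrm{supp}(\hat\beta^{\mathrm{subset}})$. Then $\hat\mu^{\mathrm{subset}}$, viewed as a function of $y$, has degrees of freedom $$\mathrm{df}(\hat\mu^{\mathrm{subset}}) = \mathbb{E}|\mathcal{A}^{\mathrm{subset}}| + \frac{\sqrt{2\lambda}}{\sigma} \sum_{i=1}^p \left[ \phi\left(\frac{\sqrt{2\lambda} - (X^T\mu)_i}{\sigma}\right) + \phi\left(\frac{\sqrt{2\lambda} + (X^T\mu)_i}{\sigma}\right) \right],$$ where $\phi$ is the standard normal density.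
   Context: For a function $f : \mathbb{R}^n \to \mathbb{R}^n$ (a fitting procedure $\hat\mu = f(y)$) and a random vector $y \in \mathbb{R}^n$ with mean $\mu$ and covariance $\sigma^2 I$, the degrees of freedom of $f$ is $$\mathrm{df}(f) = \frac{1}{\sigma^2} \sum_{i=1}^n \mathrm{Cov}\big(f_i(y), y_i\big).$$ For $\beta \in \mathbb{R}^p$, $\|\beta\|_0 = \sum_{j=1}^p 1\{\beta_j \neq 0\}$ is the number of nonzero components, and $\mathrm{supp}(\beta) = \{j : \beta_j \ne 0\}$. $|\mathcal{A}|$ denotes the cardinality of a set $\mathcal{A}$. $\hat\beta^{\mathrm{subset}}$ denotes a solution (minimizer) of the stated optimization problem for the given $y$. *)

theory Defs
  imports "HOL-Probability.Probability"
begin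

definition iso_normal_density :: "real ^ 'n \<Rightarrow> real \<Rightarrow> real ^ 'n \<Rightarrow> real" where
  "iso_normal_density \<mu> \<sigma> x =
     1 / sqrt (2 * pi * \<sigma>\<^sup>2) ^ CARD('n) * exp (- (norm (x - \<mu>))\<^sup>2 / (2 * \<sigma>\<^sup>2))"

lemma iso_normal_density_eq_prod:
  "iso_normal_density \<mu> \<sigma> x = (\<Prod>i\<in>UNIV. normal_density (\<mu> $ i) \<sigma> (x $ i))"
proof -
  have "(norm (x - \<mu>))\<^sup>2 = (\<Sum>i\<in>UNIV. (x $ i - \<mu> $ i)\<^sup>2)"
    by (simp add: norm_vec_def L2_set_def sum_nonneg)
  then show ?thesis
    by (simp add: iso_normal_density_def normal_density_def prod.distrib prod_dividef
        exp_sum[symmetric] sum_negf sum_divide_distrib)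
qed

definition supp :: "real ^ 'p \<Rightarrow> 'p set" where
  "supp \<beta> = {j. \<beta> $ j \<noteq> 0}"

definition l0_norm :: "real ^ 'p \<Rightarrow> real" where
  "l0_norm \<beta> = (\<Sum>j\<in>UNIV. of_bool (\<beta> $ j \<noteq> 0))"

definition subset_objective :: "real ^ 'p ^ 'n \<Rightarrow> real \<Rightarrow> real ^ 'n \<Rightarrow> real ^ 'p \<Rightarrow> real" where
  "subset_objective X lam v \<beta> = 1 / 2 * (norm (v - X *v \<beta>))\<^sup>2 + lam * l0_norm \<beta>"

text \<open>The Bochner integral of a non-measurable function is 0 by convention. A minimizer chosen
  arbitrarily for every data vector is determined only up to a null set (where the minimizer is not
  unique), so it need not be a Borel function. The two notions below are therefore meant to be used
  with the \<^emph>\<open>completion\<close> of the underlying probability space; for functions that are already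
  measurable this does not change any expectation (\<open>integral_completion\<close>).\<close>

definition covariance :: "'a measure \<Rightarrow> ('a \<Rightarrow> real) \<Rightarrow> ('a \<Rightarrow> real) \<Rightarrow> real" where
  "covariance M U V =
     (\<integral>\<omega>. (U \<omega> - (\<integral>\<omega>'. U \<omega>' \<partial>M)) * (V \<omega> - (\<integral>\<omega>'. V \<omega>' \<partial>M)) \<partial>M)"

definition degrees_of_freedom ::
  "'a measure \<Rightarrow> ('a \<Rightarrow> real ^ 'n) \<Rightarrow> real \<Rightarrow> (real ^ 'n \<Rightarrow> real ^ 'n) \<Rightarrow> real" where
  "degrees_of_freedom M y \<sigma> f =
     1 / \<sigma>\<^sup>2 * (\<Sum>i\<in>UNIV. covariance M (\<lambda>\<omega>. f (y \<omega>) $ i) (\<lambda>\<omega>. y \<omega> $ i))"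

end

theory Submission
  imports Defs "HOL-Real_Asymp.Real_Asymp"
begin

text \<open>
  Orthonormality of the columns of \<open>X\<close> splits the least squares term into coordinates: up to a
  constant, the objective is the sum over \<open>j\<close> of \<open>(z\<^sub>j - \<beta>\<^sub>j)\<^sup>2 / 2 + lam * [\<beta>\<^sub>j \<noteq> 0]\<close>, where
  \<open>z = X\<^sup>T y\<close>. Hence every minimizer hard-thresholds each \<open>z\<^sub>j\<close> at the level \<open>t = sqrt (2 lam)\<close>,
  except possibly at ties \<open>\<bar>z\<^sub>j\<bar> = t\<close> (\<open>subset_minimizer_eq_hard_threshold\<close>). A tie has probability
  zero, so the arbitrary choice made there is invisible to every integral over the completed
  space (\<open>integral_completion_cong_AE\<close>).

  Write \<open>H\<close> for hard thresholding at \<open>t\<close>. By bilinearity the covariances add up to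
  \<open>\<Sum>\<^sub>i Cov ((\<Sum>\<^sub>j X\<^sub>i\<^sub>j H (z\<^sub>j)), y\<^sub>i) = \<Sum>\<^sub>j Cov (H (z\<^sub>j), z\<^sub>j)\<close>, because \<open>\<Sum>\<^sub>i X\<^sub>i\<^sub>j y\<^sub>i = z\<^sub>j\<close>. Each
  summand involves one coordinate only, so all that matters is the marginal law
  \<open>z\<^sub>j \<sim> N ((X\<^sup>T \<mu>)\<^sub>j, \<sigma>\<^sup>2)\<close>, a unit combination of independent normal variables
  (\<open>iso_normal_unit_combination\<close>).

  What remains is Stein's identity for a function with two jumps. If \<open>f\<close> is the density of
  \<open>N (m, \<sigma>\<^sup>2)\<close>, then \<open>f x (x (x - m) - \<sigma>\<^sup>2)\<close> is the derivative of \<open>- \<sigma>\<^sup>2 x f x\<close>. Integrated over the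
  two tails \<open>\<bar>x\<bar> > t\<close> it leaves only the boundary terms \<open>\<sigma>\<^sup>2 t (f t + f (- t))\<close>, so that
  \<open>Cov (H Z, Z) = \<sigma>\<^sup>2 P (\<bar>Z\<bar> > t) + \<sigma>\<^sup>2 t (f t + f (- t))\<close>
  (\<open>integral_hard_threshold_normal_density\<close>). Summed over \<open>j\<close>, the probabilities give the expected
  support size, and the boundary terms give the excess caused by the search over subsets.
\<close>

section \<open>Minimizers are hard thresholding rules\<close>

text \<open>Since \<open>X\<close> is an isometry onto its range, \<open>X \<beta>\<close> may be compared with the projection of \<open>v\<close>
  on that range; the last summand is half the squared distance of \<open>v\<close> from the range, which does
  not depend on \<open>\<beta>\<close>.\<close>

lemma subset_objective_orthonormal:
  fixes X :: "real ^ 'p ^ 'n"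
  assumes X: "transpose X ** X = mat 1"
  shows "subset_objective X lam v \<beta> =
    (\<Sum>j\<in>UNIV. ((transpose X *v v) $ j - \<beta> $ j)\<^sup>2 / 2 + lam * of_bool (\<beta> $ j \<noteq> 0))
    + ((norm v)\<^sup>2 - (norm (transpose X *v v))\<^sup>2) / 2"
proof -
  let ?z = "transpose X *v v"
  have cross: "v \<bullet> (X *v \<beta>) = ?z \<bullet> \<beta>"
    by (simp add: dot_lmul_matrix transpose_matrix_vector)
  have "(X *v \<beta>) \<bullet> (X *v \<beta>) = (transpose X *v (X *v \<beta>)) \<bullet> \<beta>"
    by (simp add: dot_lmul_matrix transpose_matrix_vector)
  then have isometry: "(X *v \<beta>) \<bullet> (X *v \<beta>) = \<beta> \<bullet> \<beta>"
    by (simp add: matrix_vector_mul_assoc X)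
  have "(norm (v - X *v \<beta>))\<^sup>2 = (norm v)\<^sup>2 - 2 * (?z \<bullet> \<beta>) + \<beta> \<bullet> \<beta>"
    unfolding power2_norm_eq_inner
    by (simp add: inner_diff_left inner_diff_right cross isometry inner_commute[of "X *v \<beta>" v])
  also have "\<dots> = (norm (?z - \<beta>))\<^sup>2 + ((norm v)\<^sup>2 - (norm ?z)\<^sup>2)"
    unfolding power2_norm_eq_inner by (simp add: inner_diff_left inner_diff_right inner_commute)
  also have "(norm (?z - \<beta>))\<^sup>2 = (\<Sum>j\<in>UNIV. (?z $ j - \<beta> $ j)\<^sup>2)"
    unfolding power2_norm_eq_inner by (simp add: inner_vec_def power2_eq_square)
  finally show ?thesis
    by (simp add: subset_objective_def l0_norm_def sum.distrib sum_divide_distrib sum_distrib_left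
        add_divide_distrib)
qed

definition hard_threshold :: "real \<Rightarrow> real \<Rightarrow> real" where
  "hard_threshold t x = (if \<bar>x\<bar> > t then x else 0)"

text \<open>A nonzero value costs at least \<open>lam\<close>, with equality only at \<open>b = x\<close>, and the value zero costs
  \<open>x\<^sup>2 / 2\<close>. The costs \<open>lam\<close> and \<open>x\<^sup>2 / 2\<close> agree exactly when \<open>\<bar>x\<bar> = sqrt (2 * lam)\<close>.\<close>

lemma hard_threshold_unique_minimizer:
  fixes x b lam :: real
  assumes "lam \<ge> 0" "\<bar>x\<bar> \<noteq> sqrt (2 * lam)"
    and "(x - b)\<^sup>2 / 2 + lam * of_bool (b \<noteq> 0)
      \<le> (x - hard_threshold (sqrt (2 * lam)) x)\<^sup>2 / 2
        + lam * of_bool (hard_threshold (sqrt (2 * lam)) x \<noteq> 0)"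
  shows "b = hard_threshold (sqrt (2 * lam)) x"
proof (cases "\<bar>x\<bar> > sqrt (2 * lam)")
  case True
  have "(sqrt (2 * lam))\<^sup>2 < \<bar>x\<bar>\<^sup>2"
    using True assms(1) by (intro power_strict_mono) auto
  then have less: "2 * lam < x\<^sup>2" using assms(1) by simp
  from True assms(1) have "x \<noteq> 0"
    using real_sqrt_ge_zero[of "2 * lam"] by (auto simp del: real_sqrt_ge_0_iff)
  then have le: "(x - b)\<^sup>2 / 2 + lam * of_bool (b \<noteq> 0) \<le> lam"
    using True assms(3) by (simp add: hard_threshold_def)
  have "b \<noteq> 0" using le less by auto
  then have "(x - b)\<^sup>2 \<le> 0" using le by simp
  then show ?thesis using True by (simp add: hard_threshold_def)
next
  case False
  with assms(2) have "\<bar>x\<bar> < sqrt (2 * lam)" by simp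
  then have "\<bar>x\<bar>\<^sup>2 < (sqrt (2 * lam))\<^sup>2"
    by (intro power_strict_mono) auto
  then have less: "x\<^sup>2 < 2 * lam" using assms(1) by simp
  have le: "(x - b)\<^sup>2 / 2 + lam * of_bool (b \<noteq> 0) \<le> x\<^sup>2 / 2"
    using False assms(3) by (simp add: hard_threshold_def)
  have "b = 0"
  proof (rule ccontr)
    assume "b \<noteq> 0"
    then show False using le less zero_le_power2[of "x - b"] by simp
  qed
  then show ?thesis using False by (simp add: hard_threshold_def)
qed

lemma subset_minimizer_eq_hard_threshold:
  fixes X :: "real ^ 'p ^ 'n"
  assumes X: "transpose X ** X = mat 1" and lam: "lam \<ge> 0"
    and min: "is_arg_min (subset_objective X lam v) (\<lambda>\<beta>. True) \<beta>"
    and no_tie: "\<bar>(transpose X *v v) $ j\<bar> \<noteq> sqrt (2 * lam)"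
  shows "\<beta> $ j = hard_threshold (sqrt (2 * lam)) ((transpose X *v v) $ j)"
proof -
  let ?z = "transpose X *v v"
  define h where "h = hard_threshold (sqrt (2 * lam)) (?z $ j)"
  \<comment> \<open>The objective is separable, so it suffices to compare with a change in coordinate \<open>j\<close> alone;
    ties in the other coordinates do no harm.\<close>
  define \<beta>' where "\<beta>' = (\<chi> k. if k = j then h else \<beta> $ k)"
  define c where "c k b = (?z $ k - b)\<^sup>2 / 2 + lam * of_bool (b \<noteq> 0)" for k b
  have "subset_objective X lam v \<beta> \<le> subset_objective X lam v \<beta>'"
    using min by (simp add: is_arg_min_linorder)
  then have "(\<Sum>k\<in>UNIV. c k (\<beta> $ k)) \<le> (\<Sum>k\<in>UNIV. c k (\<beta>' $ k))"
    by (simp add: subset_objective_orthonormal[OF X] c_def)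
  moreover have "(\<Sum>k\<in>UNIV - {j}. c k (\<beta>' $ k)) = (\<Sum>k\<in>UNIV - {j}. c k (\<beta> $ k))"
    by (rule sum.cong) (auto simp: \<beta>'_def)
  ultimately have "c j (\<beta> $ j) \<le> c j h"
    by (simp add: sum.remove[of UNIV j] \<beta>'_def)
  then show ?thesis
    using hard_threshold_unique_minimizer[OF lam no_tie, of "\<beta> $ j"] by (simp add: c_def h_def)
qed

section \<open>Stein's identity for hard thresholding\<close>

context
  fixes m \<sigma> :: real
  assumes \<sigma>: "\<sigma> > 0"
begin

text \<open>The factor \<open>x * (x - m) - \<sigma>\<^sup>2\<close> is the difference of the integrands in Stein's identity
  \<open>E (g Z * (Z - m)) = \<sigma>\<^sup>2 * E (g' Z)\<close> for \<open>g x = x\<close>. As it comes with an explicit antiderivative,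
  the identity localizes to half-lines at the price of one boundary term.\<close>

lemma stein_integrand_antiderivative:
  "((\<lambda>x. - \<sigma>\<^sup>2 * (x * normal_density m \<sigma> x)) has_real_derivative
    normal_density m \<sigma> x * (x * (x - m) - \<sigma>\<^sup>2)) (at x)"
proof -
  have "(normal_density m \<sigma> has_real_derivative - (x - m) / \<sigma>\<^sup>2 * normal_density m \<sigma> x) (at x)"
  proof -
    have "((\<lambda>x. exp (- (x - m)\<^sup>2 / (2 * \<sigma>\<^sup>2))) has_real_derivative
        - (x - m) / \<sigma>\<^sup>2 * exp (- (x - m)\<^sup>2 / (2 * \<sigma>\<^sup>2))) (at x)"
      using \<sigma> by (auto intro!: derivative_eq_intros simp: field_simps power2_eq_square)
    from DERIV_cmult[OF this, of "1 / sqrt (2 * pi * \<sigma>\<^sup>2)"] show ?thesis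
      unfolding normal_density_def[abs_def] by (simp add: mult_ac)
  qed
  note deriv = DERIV_cmult[OF DERIV_mult[OF DERIV_ident this], of "- \<sigma>\<^sup>2"]
  show ?thesis
    by (rule DERIV_cong[OF deriv]) (use \<sigma> in \<open>simp add: field_simps power2_eq_square\<close>)
qed

lemma first_moment_normal_density_at_top:
  "((\<lambda>x. - \<sigma>\<^sup>2 * (x * normal_density m \<sigma> x)) \<longlongrightarrow> 0) at_top"
  unfolding normal_density_def using \<sigma> by real_asymp

lemma first_moment_normal_density_at_bot:
  "((\<lambda>x. - \<sigma>\<^sup>2 * (x * normal_density m \<sigma> x)) \<longlongrightarrow> 0) at_bot"
  unfolding normal_density_def using \<sigma> by real_asymp

lemma integrable_stein_integrand:
  "integrable lborel (\<lambda>x. normal_density m \<sigma> x * (x * (x - m) - \<sigma>\<^sup>2))"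
proof -
  have "normal_density m \<sigma> x * (x * (x - m) - \<sigma>\<^sup>2) =
      normal_density m \<sigma> x * (x - m) ^ 2 + m * (normal_density m \<sigma> x * (x - m) ^ 1)
      - \<sigma>\<^sup>2 * normal_density m \<sigma> x" for x
    by (simp add: algebra_simps power2_eq_square)
  then show ?thesis
    using integrable_normal_moment[OF \<sigma>, of m 2] integrable_normal_moment[OF \<sigma>, of m 1]
      integrable_normal_density[OF \<sigma>, of m]
    by simp
qed

lemma integral_stein_upper_tail:
  "(LINT x:{t<..}|lborel. normal_density m \<sigma> x * (x * (x - m) - \<sigma>\<^sup>2))
    = \<sigma>\<^sup>2 * t * normal_density m \<sigma> t"
proof -
  let ?F = "\<lambda>x. - \<sigma>\<^sup>2 * (x * normal_density m \<sigma> x)"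
  let ?f = "\<lambda>x. normal_density m \<sigma> x * (x * (x - m) - \<sigma>\<^sup>2)"
  have "(LBINT x=ereal t..\<infinity>. ?f x) = 0 - ?F t"
  proof (rule interval_integral_FTC_integrable)
    show "(?F has_vector_derivative ?f x) (at x)" for x
      using stein_integrand_antiderivative
      by (simp add: has_real_derivative_iff_has_vector_derivative)
    show "isCont ?f x" for x
      unfolding normal_density_def using \<sigma> by (intro continuous_intros) auto
    show "set_integrable lborel (einterval (ereal t) \<infinity>) ?f"
      unfolding set_integrable_def
      by (rule integrable_mult_indicator) (auto simp: integrable_stein_integrand)
    show "((?F \<circ> real_of_ereal) \<longlongrightarrow> 0) (at_left \<infinity>)"
      using first_moment_normal_density_at_top
      unfolding ereal_tendsto_simps .
    have "isCont ?F t"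
      using stein_integrand_antiderivative by (rule DERIV_isCont)
    then show "((?F \<circ> real_of_ereal) \<longlongrightarrow> ?F t) (at_right (ereal t))"
      unfolding ereal_tendsto_simps isCont_def by (rule tendsto_mono[OF at_le, rotated]) simp
  qed simp
  then show ?thesis
    by (simp add: interval_integral_to_infinity_eq)
qed

lemma integral_stein_lower_tail:
  "(LINT x:{..<t}|lborel. normal_density m \<sigma> x * (x * (x - m) - \<sigma>\<^sup>2))
    = - \<sigma>\<^sup>2 * t * normal_density m \<sigma> t"
proof -
  let ?F = "\<lambda>x. - \<sigma>\<^sup>2 * (x * normal_density m \<sigma> x)"
  let ?f = "\<lambda>x. normal_density m \<sigma> x * (x * (x - m) - \<sigma>\<^sup>2)"
  have "(LBINT x=-\<infinity>..ereal t. ?f x) = ?F t - 0"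
  proof (rule interval_integral_FTC_integrable)
    show "(?F has_vector_derivative ?f x) (at x)" for x
      using stein_integrand_antiderivative
      by (simp add: has_real_derivative_iff_has_vector_derivative)
    show "isCont ?f x" for x
      unfolding normal_density_def using \<sigma> by (intro continuous_intros) auto
    show "set_integrable lborel (einterval (-\<infinity>) (ereal t)) ?f"
      unfolding set_integrable_def
      by (rule integrable_mult_indicator) (auto simp: integrable_stein_integrand)
    show "((?F \<circ> real_of_ereal) \<longlongrightarrow> 0) (at_right (-\<infinity>))"
      using first_moment_normal_density_at_bot
      unfolding ereal_tendsto_simps .
    have "isCont ?F t"
      using stein_integrand_antiderivative by (rule DERIV_isCont)
    then show "((?F \<circ> real_of_ereal) \<longlongrightarrow> ?F t) (at_left (ereal t))"
      unfolding ereal_tendsto_simps isCont_def by (rule tendsto_mono[OF at_le, rotated]) simp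
  qed simp
  moreover have "einterval (-\<infinity>) (ereal t) = {..<t}" by (auto simp: einterval_def)
  ultimately show ?thesis
    by (simp add: interval_lebesgue_integral_def)
qed

text \<open>Where it does not vanish, the threshold function is the identity, so on the two tails the
  Stein integrand applies. The tails are disjoint because \<open>t \<ge> 0\<close>.\<close>

lemma integral_hard_threshold_normal_density:
  assumes t: "t \<ge> 0"
  shows "(\<integral>x. normal_density m \<sigma> x * (hard_threshold t x * (x - m)) \<partial>lborel) =
    \<sigma>\<^sup>2 * (\<integral>x. normal_density m \<sigma> x * of_bool (hard_threshold t x \<noteq> 0) \<partial>lborel) +
    \<sigma>\<^sup>2 * t * (normal_density m \<sigma> t + normal_density m \<sigma> (- t))"
proof -
  let ?f = "\<lambda>x. normal_density m \<sigma> x * (x * (x - m) - \<sigma>\<^sup>2)"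
  let ?P = "\<lambda>x. normal_density m \<sigma> x * of_bool (hard_threshold t x \<noteq> 0)"
  have int: "integrable lborel (\<lambda>x. indicator A x *\<^sub>R ?f x)" if "A \<in> sets borel" for A
    using that by (intro integrable_mult_indicator integrable_stein_integrand) simp
  have "(\<lambda>x. of_bool (hard_threshold t x \<noteq> 0) :: real) = indicator ({t<..} \<union> {..<-t})"
    using t by (auto simp: hard_threshold_def indicator_def fun_eq_iff abs_if)
  moreover have "integrable lborel (\<lambda>x. indicator ({t<..} \<union> {..<-t}) x *\<^sub>R normal_density m \<sigma> x)"
    by (intro integrable_mult_indicator integrable_normal_density[OF \<sigma>]) simp
  ultimately have P: "integrable lborel ?P"
    by (simp add: mult.commute fun_eq_iff)
  have "normal_density m \<sigma> x * (hard_threshold t x * (x - m)) =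
      indicator {t<..} x *\<^sub>R ?f x + indicator {..<-t} x *\<^sub>R ?f x + \<sigma>\<^sup>2 * ?P x" for x
    using t by (auto simp: hard_threshold_def indicator_def algebra_simps)
  then have "(\<integral>x. normal_density m \<sigma> x * (hard_threshold t x * (x - m)) \<partial>lborel) =
      (LINT x:{t<..}|lborel. ?f x) + (LINT x:{..<-t}|lborel. ?f x) + \<sigma>\<^sup>2 * (\<integral>x. ?P x \<partial>lborel)"
    using P int by (simp add: set_lebesgue_integral_def del: real_scaleR_def)
  then show ?thesis
    unfolding integral_stein_upper_tail integral_stein_lower_tail
    by (simp add: algebra_simps)
qed

lemma normal_density_standardize:
  "normal_density m \<sigma> x = std_normal_density ((x - m) / \<sigma>) / \<sigma>"
  using \<sigma> by (simp add: normal_density_def real_sqrt_mult power_divide)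

end

section \<open>Integrals and covariances over the completion\<close>

text \<open>A function on the completed space needs no measurability of its own to be integrated, as soon
  as it agrees almost everywhere with a measurable one. This is how minimizers with arbitrary
  choices at ties become tractable.\<close>

lemma integral_completion_cong_AE:
  fixes U V :: "'a \<Rightarrow> real"
  assumes V: "V \<in> borel_measurable M" and eq: "AE \<omega> in M. U \<omega> = V \<omega>"
  shows "(\<integral>\<omega>. U \<omega> \<partial>completion M) = (\<integral>\<omega>. V \<omega> \<partial>M)"
proof -
  have eq': "AE \<omega> in completion M. U \<omega> = V \<omega>"
    using eq by (rule AE_completion)
  have V': "V \<in> borel_measurable (completion M)"
    using V by (rule measurable_completion)
  have U: "U \<in> borel_measurable (completion M)"
  proof (rule measurableI)
    fix A :: "real set" assume "A \<in> sets borel"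
    then have "V -` A \<inter> space M \<in> sets (completion M)"
      using measurable_sets[OF V'] by simp
    moreover have "AE \<omega> in completion M. \<omega> \<in> V -` A \<inter> space M \<longleftrightarrow> \<omega> \<in> U -` A \<inter> space M"
      using eq' by eventually_elim simp
    ultimately show "U -` A \<inter> space (completion M) \<in> sets (completion M)"
      using completion.in_sets_AE[where A = "V -` A \<inter> space M" and B = "U -` A \<inter> space M"]
      by simp
  qed simp
  from eq' show ?thesis
    unfolding integral_completion[OF V, symmetric]
    by (intro integral_cong_AE U V') auto
qed

lemma covariance_completion_cong_AE:
  fixes U U' V V' :: "'a \<Rightarrow> real"
  assumes U': "U' \<in> borel_measurable M" and V': "V' \<in> borel_measurable M"
    and U: "AE \<omega> in M. U \<omega> = U' \<omega>" and V: "AE \<omega> in M. V \<omega> = V' \<omega>"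
  shows "covariance (completion M) U V = covariance M U' V'"
  unfolding covariance_def integral_completion_cong_AE[OF U' U] integral_completion_cong_AE[OF V' V]
proof (rule integral_completion_cong_AE)
  show "AE \<omega> in M. (U \<omega> - integral\<^sup>L M U') * (V \<omega> - integral\<^sup>L M V') =
      (U' \<omega> - integral\<^sup>L M U') * (V' \<omega> - integral\<^sup>L M V')"
    using U V by eventually_elim simp
qed (use U' V' in measurable)

text \<open>Only one factor of a covariance has to be centred. Leaving the fit uncentred keeps the sum over
  coordinates in the main argument linear in the fit.\<close>

lemma (in prob_space) covariance_eq_centred_second:
  fixes U V :: "'a \<Rightarrow> real"
  assumes U: "integrable M U" and V: "integrable M V" and UV: "integrable M (\<lambda>\<omega>. U \<omega> * V \<omega>)"
  shows "covariance M U V = (\<integral>\<omega>. U \<omega> * (V \<omega> - (\<integral>\<omega>'. V \<omega>' \<partial>M)) \<partial>M)"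
proof -
  define u where "u = (\<integral>\<omega>. U \<omega> \<partial>M)"
  define v where "v = (\<integral>\<omega>. V \<omega> \<partial>M)"
  have centred: "(\<integral>\<omega>. V \<omega> - v \<partial>M) = 0"
    using V by (simp add: v_def prob_space)
  have int: "integrable M (\<lambda>\<omega>. U \<omega> * (V \<omega> - v))"
    using U UV by (simp add: right_diff_distrib)
  have "covariance M U V = (\<integral>\<omega>. U \<omega> * (V \<omega> - v) - u * (V \<omega> - v) \<partial>M)"
    unfolding covariance_def u_def[symmetric] v_def[symmetric] by (simp add: left_diff_distrib)
  also have "\<dots> = (\<integral>\<omega>. U \<omega> * (V \<omega> - v) \<partial>M) - u * (\<integral>\<omega>. V \<omega> - v \<partial>M)"
    using int V by simp
  finally show ?thesis
    by (simp only: centred) (simp add: v_def)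
qed

section \<open>Unit combinations of an isotropic normal vector\<close>

lemma nn_integral_lborel_vec_prod:
  fixes g :: "'n::finite \<Rightarrow> real \<Rightarrow> ennreal"
  assumes g: "\<And>i. g i \<in> borel_measurable borel"
  shows "(\<integral>\<^sup>+x. (\<Prod>i\<in>UNIV. g i (x $ i)) \<partial>(lborel :: (real ^ 'n) measure))
    = (\<Prod>i\<in>UNIV. \<integral>\<^sup>+t. g i t \<partial>lborel)"
proof -
  have inj: "inj (\<lambda>i::'n. axis i (1::real))"
    by (auto simp: inj_on_def axis_eq_axis)
  have Basis: "(Basis :: (real ^ 'n) set) = range (\<lambda>i. axis i 1)"
    by (auto simp: Basis_vec_def)
  \<comment> \<open>The product formula over \<open>Basis\<close> wants factors indexed by basis vectors rather than by
    coordinates.\<close>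
  define f where "f b = g (inv (\<lambda>i::'n. axis i (1::real)) b)" for b
  have f: "f (axis i 1) = g i" for i
    by (simp add: f_def inv_f_f[OF inj])
  have "(\<integral>\<^sup>+x. (\<Prod>b\<in>Basis. f b (x \<bullet> b)) \<partial>(lborel :: (real ^ 'n) measure))
    = (\<Prod>b\<in>Basis. \<integral>\<^sup>+t. f b t \<partial>lborel)"
    by (rule nn_integral_lborel_prod) (auto simp: f_def g)
  then show ?thesis
    by (simp add: Basis prod.reindex[OF inj] f inner_axis)
qed

context prob_space
begin

text \<open>The density is a product, so Tonelli's theorem factorizes the probability of a rectangle.
  Both the marginal laws and the independence of the coordinates are read off from this.\<close>

lemma iso_normal_prob_rectangle:
  fixes y :: "'a \<Rightarrow> real ^ 'n"
  assumes y: "distributed M lborel y (\<lambda>x. ennreal (iso_normal_density \<mu> \<sigma> x))"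
    and A: "\<And>i. A i \<in> sets borel"
  shows "emeasure M {\<omega> \<in> space M. \<forall>i. y \<omega> $ i \<in> A i}
    = (\<Prod>i\<in>UNIV. emeasure (density lborel (normal_density (\<mu> $ i) \<sigma>)) (A i))"
proof -
  let ?R = "{x :: real ^ 'n. \<forall>i. x $ i \<in> A i}"
  have "?R = (\<Inter>i. (\<lambda>x. x $ i) -` A i)" by auto
  also have "\<dots> \<in> sets borel"
    using A by (intro sets.countable_INT'') (auto intro!: measurable_sets_borel[OF _ A] borel_measurable_continuous_onI continuous_intros)
  finally have R: "?R \<in> sets lborel" by simp
  have ind: "indicator ?R x = (\<Prod>i\<in>UNIV. indicator (A i) (x $ i) :: ennreal)" for x
    by (auto simp: indicator_def)
  have "{\<omega> \<in> space M. \<forall>i. y \<omega> $ i \<in> A i} = y -` ?R \<inter> space M" by auto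
  also have "emeasure M \<dots> = (\<integral>\<^sup>+x. ennreal (iso_normal_density \<mu> \<sigma> x) * indicator ?R x \<partial>lborel)"
    by (rule distributed_emeasure[OF y R])
  also have "\<dots> = (\<integral>\<^sup>+x. (\<Prod>i\<in>UNIV. ennreal (normal_density (\<mu> $ i) \<sigma> (x $ i)) * indicator (A i) (x $ i)) \<partial>lborel)"
    by (simp add: iso_normal_density_eq_prod prod_ennreal[symmetric] ind prod.distrib)
  also have "\<dots> = (\<Prod>i\<in>UNIV. \<integral>\<^sup>+t. ennreal (normal_density (\<mu> $ i) \<sigma> t) * indicator (A i) t \<partial>lborel)"
    using A by (intro nn_integral_lborel_vec_prod) simp
  also have "\<dots> = (\<Prod>i\<in>UNIV. emeasure (density lborel (normal_density (\<mu> $ i) \<sigma>)) (A i))"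
    using A by (simp add: emeasure_density)
  finally show ?thesis .
qed

lemma iso_normal_measurable_coordinate:
  fixes y :: "'a \<Rightarrow> real ^ 'n"
  assumes y: "distributed M lborel y (\<lambda>x. ennreal (iso_normal_density \<mu> \<sigma> x))"
  shows "(\<lambda>\<omega>. y \<omega> $ i) \<in> borel_measurable M"
proof -
  have "y \<in> borel_measurable M"
    using distributed_measurable[OF y] by simp
  then show ?thesis
    by (rule measurable_compose[OF _ borel_measurable_continuous_onI[OF continuous_on_component]])
       (rule continuous_on_id)
qed

lemma iso_normal_coordinate_emeasure:
  fixes y :: "'a \<Rightarrow> real ^ 'n"
  assumes y: "distributed M lborel y (\<lambda>x. ennreal (iso_normal_density \<mu> \<sigma> x))"
    and \<sigma>: "\<sigma> > 0" and B: "B \<in> sets borel"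
  shows "emeasure M ((\<lambda>\<omega>. y \<omega> $ i) -` B \<inter> space M)
    = emeasure (density lborel (normal_density (\<mu> $ i) \<sigma>)) B"
proof -
  let ?A = "\<lambda>k. if k = i then B else UNIV"
  have "(\<lambda>\<omega>. y \<omega> $ i) -` B \<inter> space M = {\<omega> \<in> space M. \<forall>k. y \<omega> $ k \<in> ?A k}"
    by auto
  also have "emeasure M \<dots> = (\<Prod>k\<in>UNIV. emeasure (density lborel (normal_density (\<mu> $ k) \<sigma>)) (?A k))"
    using B by (intro iso_normal_prob_rectangle[OF y]) auto
  also have "\<dots> = emeasure (density lborel (normal_density (\<mu> $ i) \<sigma>)) B *
      (\<Prod>k\<in>UNIV - {i}. emeasure (density lborel (normal_density (\<mu> $ k) \<sigma>)) UNIV)"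
    by (subst prod.remove[of UNIV i]) (auto intro!: arg_cong2[where f = "(*)"] prod.cong)
  also have "(\<Prod>k\<in>UNIV - {i}. emeasure (density lborel (normal_density (\<mu> $ k) \<sigma>)) UNIV) = 1"
    using prob_space.emeasure_space_1[OF prob_space_normal_density[OF \<sigma>]] by simp
  finally show ?thesis by simp
qed

lemma iso_normal_coordinate_distributed:
  fixes y :: "'a \<Rightarrow> real ^ 'n"
  assumes y: "distributed M lborel y (\<lambda>x. ennreal (iso_normal_density \<mu> \<sigma> x))"
    and \<sigma>: "\<sigma> > 0"
  shows "distributed M lborel (\<lambda>\<omega>. y \<omega> $ i) (normal_density (\<mu> $ i) \<sigma>)"
  unfolding distributed_def
proof (intro conjI measure_eqI)
  show "(\<lambda>\<omega>. y \<omega> $ i) \<in> measurable M lborel"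
    using iso_normal_measurable_coordinate[OF y] by simp
  fix B assume "B \<in> sets (distr M lborel (\<lambda>\<omega>. y \<omega> $ i))"
  then show "emeasure (distr M lborel (\<lambda>\<omega>. y \<omega> $ i)) B =
      emeasure (density lborel (\<lambda>x. ennreal (normal_density (\<mu> $ i) \<sigma> x))) B"
    using iso_normal_measurable_coordinate[OF y] iso_normal_coordinate_emeasure[OF y \<sigma>]
    by (simp add: emeasure_distr)
qed auto

lemma iso_normal_indep_coordinates:
  fixes y :: "'a \<Rightarrow> real ^ 'n"
  assumes y: "distributed M lborel y (\<lambda>x. ennreal (iso_normal_density \<mu> \<sigma> x))"
    and \<sigma>: "\<sigma> > 0"
  shows "indep_vars (\<lambda>_. borel) (\<lambda>i \<omega>. y \<omega> $ i) UNIV"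
proof (subst indep_vars_finite[where E = "\<lambda>_. sets borel"])
  show "\<forall>A\<in>UNIV \<rightarrow> sets borel.
     prob (\<Inter>j. (\<lambda>\<omega>. y \<omega> $ j) -` A j \<inter> space M) = (\<Prod>j\<in>UNIV. prob ((\<lambda>\<omega>. y \<omega> $ j) -` A j \<inter> space M))"
  proof
    fix A :: "'n \<Rightarrow> real set" assume "A \<in> UNIV \<rightarrow> sets borel"
    then have A: "A i \<in> sets borel" for i by auto
    have "(\<Inter>j. (\<lambda>\<omega>. y \<omega> $ j) -` A j \<inter> space M) = {\<omega> \<in> space M. \<forall>i. y \<omega> $ i \<in> A i}"
      by auto
    then have "ennreal (prob (\<Inter>j. (\<lambda>\<omega>. y \<omega> $ j) -` A j \<inter> space M)) =
        (\<Prod>j\<in>UNIV. ennreal (prob ((\<lambda>\<omega>. y \<omega> $ j) -` A j \<inter> space M)))"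
      using iso_normal_prob_rectangle[OF y A] iso_normal_coordinate_emeasure[OF y \<sigma> A]
      by (simp add: emeasure_eq_measure[symmetric])
    then show "prob (\<Inter>j. (\<lambda>\<omega>. y \<omega> $ j) -` A j \<inter> space M) = (\<Prod>j\<in>UNIV. prob ((\<lambda>\<omega>. y \<omega> $ j) -` A j \<inter> space M))"
      by (simp add: prod_ennreal prod_nonneg)
  qed
qed (auto simp: iso_normal_measurable_coordinate[OF y] Int_stable_def sets.sigma_sets_eq[of borel, simplified])

text \<open>This covers in particular the projection of the data on a column of a matrix with orthonormal
  columns.\<close>

lemma iso_normal_unit_combination:
  fixes y :: "'a \<Rightarrow> real ^ 'n"
  assumes y: "distributed M lborel y (\<lambda>x. ennreal (iso_normal_density \<mu> \<sigma> x))"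
    and \<sigma>: "\<sigma> > 0" and w: "norm w = 1"
  shows "distributed M lborel (\<lambda>\<omega>. w \<bullet> y \<omega>) (normal_density (w \<bullet> \<mu>) \<sigma>)"
proof -
  \<comment> \<open>Coordinates of weight zero contribute a constant, which is not normal with positive variance,
    and have to be left out of the sum of independent normal variables.\<close>
  let ?I = "{i. w $ i \<noteq> 0}"
  have restrict: "(\<Sum>i\<in>?I. w $ i * v $ i) = w \<bullet> v" for v
    by (auto simp: inner_vec_def intro!: sum.mono_neutral_left)
  have "w \<noteq> 0" using w by auto
  then have "?I \<noteq> {}" by (auto simp: vec_eq_iff)
  have indep: "indep_vars (\<lambda>_. borel) (\<lambda>i \<omega>. w $ i * y \<omega> $ i) ?I"
    by (rule indep_vars_compose2[OF indep_vars_subset[OF iso_normal_indep_coordinates[OF y \<sigma>]]]) auto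
  have scaled: "distributed M lborel (\<lambda>\<omega>. w $ i * y \<omega> $ i)
      (normal_density (w $ i * \<mu> $ i) (\<bar>w $ i\<bar> * \<sigma>))" if "i \<in> ?I" for i
    using normal_density_affine[OF iso_normal_coordinate_distributed[OF y \<sigma>] \<sigma>, of "w $ i" 0 i] that
    by simp
  have "distributed M lborel (\<lambda>\<omega>. \<Sum>i\<in>?I. w $ i * y \<omega> $ i)
      (normal_density (\<Sum>i\<in>?I. w $ i * \<mu> $ i) (sqrt (\<Sum>i\<in>?I. (\<bar>w $ i\<bar> * \<sigma>)\<^sup>2)))"
    using \<sigma> by (intro sum_indep_normal indep scaled \<open>?I \<noteq> {}\<close>) auto
  also have "(\<Sum>i\<in>?I. (\<bar>w $ i\<bar> * \<sigma>)\<^sup>2) = \<sigma>\<^sup>2 * (w \<bullet> w)"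
    by (simp add: restrict[symmetric] power_mult_distrib sum_distrib_left power2_eq_square mult_ac)
  finally show ?thesis
    using \<sigma> w by (simp add: restrict norm_eq_1)
qed

end

section \<open>Degrees of freedom of best subset selection\<close>

lemma integrable_mult_square_integrable:
  fixes U V :: "'a \<Rightarrow> real"
  assumes U[measurable]: "U \<in> borel_measurable M" and V[measurable]: "V \<in> borel_measurable M"
    and U2: "integrable M (\<lambda>\<omega>. (U \<omega>)\<^sup>2)" and V2: "integrable M (\<lambda>\<omega>. (V \<omega>)\<^sup>2)"
  shows "integrable M (\<lambda>\<omega>. U \<omega> * V \<omega>)"
proof (rule Bochner_Integration.integrable_bound[OF Bochner_Integration.integrable_add[OF U2 V2]])
  have "\<bar>u * v\<bar> \<le> u\<^sup>2 + v\<^sup>2" for u v :: real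
    using sum_squares_bound[of "\<bar>u\<bar>" "\<bar>v\<bar>"] mult_nonneg_nonneg[of "\<bar>u\<bar>" "\<bar>v\<bar>"]
    unfolding abs_mult power2_abs by linarith
  then show "AE \<omega> in M. norm (U \<omega> * V \<omega>) \<le> norm ((U \<omega>)\<^sup>2 + (V \<omega>)\<^sup>2)"
    by simp
qed simp

lemma (in prob_space) normal_square_integrable:
  fixes Z :: "'a \<Rightarrow> real"
  assumes Z: "distributed M lborel Z (normal_density m \<sigma>)" and \<sigma>: "\<sigma> > 0"
  shows "integrable M (\<lambda>\<omega>. (Z \<omega>)\<^sup>2)"
proof -
  have "normal_density m \<sigma> x * x\<^sup>2 = normal_density m \<sigma> x * (x - m) ^ 2
      + 2 * m * (normal_density m \<sigma> x * (x - m) ^ 1) + m\<^sup>2 * normal_density m \<sigma> x" for x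
    by (simp add: algebra_simps power2_eq_square)
  then have "integrable lborel (\<lambda>x. normal_density m \<sigma> x * x\<^sup>2)"
    using integrable_normal_moment[OF \<sigma>, of m 2] integrable_normal_moment[OF \<sigma>, of m 1]
      integrable_normal_density[OF \<sigma>, of m]
    by simp
  then show ?thesis
    using distributed_integrable[OF Z, of "\<lambda>x. x\<^sup>2"] by simp
qed

text \<open>With \<open>t = sqrt (2 * lam)\<close>, this says that ties in the thresholding rule almost surely do not
  occur.\<close>

lemma (in prob_space) normal_AE_abs_neq:
  fixes Z :: "'a \<Rightarrow> real"
  assumes Z: "distributed M lborel Z (normal_density m \<sigma>)"
  shows "AE \<omega> in M. \<bar>Z \<omega>\<bar> \<noteq> t"
proof -
  have "AE x in lborel. \<bar>x :: real\<bar> \<noteq> t"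
    using AE_lborel_singleton[of t] AE_lborel_singleton[of "- t"] by eventually_elim auto
  then show ?thesis
    by (subst distributed_AE2[OF Z]) auto
qed

lemma borel_measurable_hard_threshold[measurable]: "hard_threshold t \<in> borel_measurable borel"
  unfolding hard_threshold_def[abs_def] by measurable

lemma (in prob_space) hard_threshold_normal_expectation:
  fixes Z :: "'a \<Rightarrow> real"
  assumes Z: "distributed M lborel Z (normal_density m \<sigma>)" and \<sigma>: "\<sigma> > 0" and t: "t \<ge> 0"
  shows "(\<integral>\<omega>. hard_threshold t (Z \<omega>) * (Z \<omega> - m) \<partial>M) =
    \<sigma>\<^sup>2 * ((\<integral>\<omega>. of_bool (hard_threshold t (Z \<omega>) \<noteq> 0) \<partial>M) +
      t / \<sigma> * (std_normal_density ((t - m) / \<sigma>) + std_normal_density ((t + m) / \<sigma>)))"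
proof -
  have "std_normal_density ((- t - m) / \<sigma>) = std_normal_density ((t + m) / \<sigma>)"
    by (simp add: normal_density_def power_divide power2_eq_square algebra_simps)
  then have dens: "normal_density m \<sigma> t + normal_density m \<sigma> (- t) =
      (std_normal_density ((t - m) / \<sigma>) + std_normal_density ((t + m) / \<sigma>)) / \<sigma>"
    by (simp add: normal_density_standardize[OF \<sigma>] add_divide_distrib)
  have 1: "(\<integral>x. normal_density m \<sigma> x * (hard_threshold t x * (x - m)) \<partial>lborel) =
      (\<integral>\<omega>. hard_threshold t (Z \<omega>) * (Z \<omega> - m) \<partial>M)"
    by (rule distributed_integral[OF Z]) simp_all
  have 2: "(\<integral>x. normal_density m \<sigma> x * of_bool (hard_threshold t x \<noteq> 0) \<partial>lborel) =
      (\<integral>\<omega>. of_bool (hard_threshold t (Z \<omega>) \<noteq> 0) \<partial>M)"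
    by (rule distributed_integral[OF Z]) simp_all
  show ?thesis
    using integral_hard_threshold_normal_density[OF \<sigma> t, of m]
    unfolding 1 2 dens by (simp add: distrib_left add_divide_distrib)
qed

theorem theorem2:
  fixes M :: "'a measure"
    and y :: "'a \<Rightarrow> real ^ 'n"
    and \<mu> :: "real ^ 'n"
    and \<sigma> lam :: real
    and X :: "real ^ 'p ^ 'n"
    and \<beta>hat :: "real ^ 'n \<Rightarrow> real ^ 'p"
  assumes "prob_space M"
    and "\<sigma> > 0"
    and "distributed M lborel y (\<lambda>x. ennreal (iso_normal_density \<mu> \<sigma> x))"
    and "transpose X ** X = mat 1"
    and "lam \<ge> 0"
    and "\<And>v. is_arg_min (subset_objective X lam v) (\<lambda>\<beta>. True) (\<beta>hat v)"
  shows "degrees_of_freedom (completion M) y \<sigma> (\<lambda>v. X *v \<beta>hat v) =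
      (\<integral>\<omega>. real (card (supp (\<beta>hat (y \<omega>)))) \<partial>completion M) +
      sqrt (2 * lam) / \<sigma> *
        (\<Sum>i\<in>UNIV.
          std_normal_density ((sqrt (2 * lam) - (transpose X *v \<mu>) $ i) / \<sigma>) +
          std_normal_density ((sqrt (2 * lam) + (transpose X *v \<mu>) $ i) / \<sigma>))"
proof -
  interpret prob_space M by fact
  note \<sigma> = assms(2) and y = assms(3) and X = assms(4) and lam = assms(5) and min = assms(6)
  define t where "t = sqrt (2 * lam)"
  have t: "t \<ge> 0" using lam by (simp add: t_def)
  define z where "z j \<omega> = (transpose X *v y \<omega>) $ j" for j \<omega>
  define m where "m j = (transpose X *v \<mu>) $ j" for j
  define b where "b j \<omega> = hard_threshold t (z j \<omega>)" for j \<omega>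
  \<comment> \<open>\<open>b\<close> and \<open>fit\<close> are measurable versions of the selected coefficients and of the fit.\<close>
  define fit where "fit i \<omega> = (\<Sum>j\<in>UNIV. X $ i $ j * b j \<omega>)" for i \<omega>
  have proj: "(transpose X *v v) $ j = column j X \<bullet> v" for v j
    by (simp add: matrix_vector_mult_def transpose_def column_def inner_vec_def)
  have unit: "norm (column j X) = 1" for j
  proof -
    have "column j X \<bullet> column j X = (transpose X ** X) $ j $ j"
      by (simp add: matrix_matrix_mult_def transpose_def column_def inner_vec_def)
    then show ?thesis by (simp add: X mat_def norm_eq_1)
  qed
  have z_distr: "distributed M lborel (z j) (normal_density (m j) \<sigma>)" for j
    using iso_normal_unit_combination[OF y \<sigma> unit, of j]
    unfolding z_def[abs_def] m_def proj .
  have y_distr: "distributed M lborel (\<lambda>\<omega>. y \<omega> $ i) (normal_density (\<mu> $ i) \<sigma>)" for i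
    by (rule iso_normal_coordinate_distributed[OF y \<sigma>])
  have z_meas[measurable]: "z j \<in> borel_measurable M" for j
    using distributed_measurable[OF z_distr] by simp
  have y_meas[measurable]: "(\<lambda>\<omega>. y \<omega> $ i) \<in> borel_measurable M" for i
    using distributed_measurable[OF y_distr] by simp
  have b_meas[measurable]: "b j \<in> borel_measurable M" for j
    unfolding b_def[abs_def] by measurable
  have fit_meas[measurable]: "fit i \<in> borel_measurable M" for i
    unfolding fit_def[abs_def] by measurable
  have y2: "integrable M (\<lambda>\<omega>. (y \<omega> $ i)\<^sup>2)" for i
    by (rule normal_square_integrable[OF y_distr \<sigma>])
  have b2: "integrable M (\<lambda>\<omega>. (b j \<omega>)\<^sup>2)" for j
    by (rule Bochner_Integration.integrable_bound[OF normal_square_integrable[OF z_distr \<sigma>, of j]])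
       (auto simp: b_def hard_threshold_def)
  have y1: "integrable M (\<lambda>\<omega>. y \<omega> $ i)" for i
    using square_integrable_imp_integrable[OF y_meas y2] .
  have b1: "integrable M (b j)" for j
    using square_integrable_imp_integrable[OF b_meas b2] .
  have by_int: "integrable M (\<lambda>\<omega>. b j \<omega> * y \<omega> $ i)" for i j
    by (rule integrable_mult_square_integrable[OF b_meas y_meas b2 y2])
  have term_int: "integrable M (\<lambda>\<omega>. b j \<omega> * (X $ i $ j * (y \<omega> $ i - \<mu> $ i)))" for i j
  proof -
    have "integrable M (\<lambda>\<omega>. X $ i $ j * (b j \<omega> * y \<omega> $ i) - X $ i $ j * \<mu> $ i * b j \<omega>)"
      using b1 by_int by simp
    then show ?thesis by (simp add: algebra_simps)
  qed
  have y_mean: "(\<integral>\<omega>. y \<omega> $ i \<partial>M) = \<mu> $ i" for i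
    by (rule normal_distributed_expectation[OF \<sigma> y_distr])

  have \<beta>hat_AE: "AE \<omega> in M. \<forall>j. \<beta>hat (y \<omega>) $ j = b j \<omega>"
  proof -
    have "AE \<omega> in M. \<forall>j. \<bar>z j \<omega>\<bar> \<noteq> t"
      using normal_AE_abs_neq[OF z_distr] by (simp add: AE_all_countable)
    then show ?thesis
      unfolding b_def z_def t_def
      by eventually_elim (intro allI subset_minimizer_eq_hard_threshold[OF X lam min], blast)
  qed

  have cov: "covariance (completion M) (\<lambda>\<omega>. (X *v \<beta>hat (y \<omega>)) $ i) (\<lambda>\<omega>. y \<omega> $ i) =
      (\<Sum>j\<in>UNIV. \<integral>\<omega>. b j \<omega> * (X $ i $ j * (y \<omega> $ i - \<mu> $ i)) \<partial>M)" for i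
  proof -
    have "covariance (completion M) (\<lambda>\<omega>. (X *v \<beta>hat (y \<omega>)) $ i) (\<lambda>\<omega>. y \<omega> $ i) =
        covariance M (fit i) (\<lambda>\<omega>. y \<omega> $ i)"
    proof (rule covariance_completion_cong_AE)
      show "AE \<omega> in M. (X *v \<beta>hat (y \<omega>)) $ i = fit i \<omega>"
        using \<beta>hat_AE by eventually_elim (simp add: fit_def matrix_vector_mult_def)
    qed simp_all
    also have "\<dots> = (\<integral>\<omega>. fit i \<omega> * (y \<omega> $ i - \<mu> $ i) \<partial>M)"
    proof (subst covariance_eq_centred_second)
      show "integrable M (fit i)"
        unfolding fit_def[abs_def] using b1 by simp
      show "integrable M (\<lambda>\<omega>. fit i \<omega> * y \<omega> $ i)"
        unfolding fit_def[abs_def] using by_int by (simp add: sum_distrib_right mult.assoc)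
    qed (simp_all add: y1 y_mean)
    also have "\<dots> = (\<integral>\<omega>. (\<Sum>j\<in>UNIV. b j \<omega> * (X $ i $ j * (y \<omega> $ i - \<mu> $ i))) \<partial>M)"
      unfolding fit_def sum_distrib_right by (simp only: mult_ac)
    also have "\<dots> = (\<Sum>j\<in>UNIV. \<integral>\<omega>. b j \<omega> * (X $ i $ j * (y \<omega> $ i - \<mu> $ i)) \<partial>M)"
      by (intro Bochner_Integration.integral_sum term_int)
    finally show ?thesis .
  qed

  \<comment> \<open>Summing over the data coordinates first recombines the \<open>y\<^sub>i\<close> into \<open>z\<^sub>j\<close>, so that one normal
    variable is left in each summand.\<close>
  have "(\<Sum>i\<in>UNIV. covariance (completion M) (\<lambda>\<omega>. (X *v \<beta>hat (y \<omega>)) $ i) (\<lambda>\<omega>. y \<omega> $ i)) =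
      (\<Sum>j\<in>UNIV. \<Sum>i\<in>UNIV. \<integral>\<omega>. b j \<omega> * (X $ i $ j * (y \<omega> $ i - \<mu> $ i)) \<partial>M)"
    unfolding cov by (rule sum.swap)
  also have "\<dots> = (\<Sum>j\<in>UNIV. \<integral>\<omega>. (\<Sum>i\<in>UNIV. b j \<omega> * (X $ i $ j * (y \<omega> $ i - \<mu> $ i))) \<partial>M)"
    by (intro sum.cong refl Bochner_Integration.integral_sum[symmetric] term_int)
  also have "\<dots> = (\<Sum>j\<in>UNIV. \<integral>\<omega>. b j \<omega> * (z j \<omega> - m j) \<partial>M)"
    by (simp add: z_def m_def matrix_vector_mult_def transpose_def sum_distrib_left[symmetric]
        sum_subtractf right_diff_distrib)
  also have "\<dots> = (\<Sum>j\<in>UNIV. \<sigma>\<^sup>2 * ((\<integral>\<omega>. of_bool (b j \<omega> \<noteq> 0) \<partial>M) +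
      t / \<sigma> * (std_normal_density ((t - m j) / \<sigma>) + std_normal_density ((t + m j) / \<sigma>))))"
    unfolding b_def by (simp only: hard_threshold_normal_expectation[OF z_distr \<sigma> t])
  also have "\<dots> = \<sigma>\<^sup>2 * ((\<Sum>j\<in>UNIV. \<integral>\<omega>. of_bool (b j \<omega> \<noteq> 0) \<partial>M) +
      t / \<sigma> * (\<Sum>j\<in>UNIV. std_normal_density ((t - m j) / \<sigma>) + std_normal_density ((t + m j) / \<sigma>)))"
    by (simp only: sum_distrib_left[symmetric] sum.distrib)
  finally have df: "degrees_of_freedom (completion M) y \<sigma> (\<lambda>v. X *v \<beta>hat v) =
      (\<Sum>j\<in>UNIV. \<integral>\<omega>. of_bool (b j \<omega> \<noteq> 0) \<partial>M) +
      t / \<sigma> * (\<Sum>j\<in>UNIV. std_normal_density ((t - m j) / \<sigma>) + std_normal_density ((t + m j) / \<sigma>))"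
    unfolding degrees_of_freedom_def using \<sigma> by simp

  have "(\<integral>\<omega>. real (card (supp (\<beta>hat (y \<omega>)))) \<partial>completion M) =
      (\<integral>\<omega>. (\<Sum>j\<in>UNIV. of_bool (b j \<omega> \<noteq> 0)) \<partial>M)"
  proof (rule integral_completion_cong_AE)
    show "AE \<omega> in M. real (card (supp (\<beta>hat (y \<omega>)))) = (\<Sum>j\<in>UNIV. of_bool (b j \<omega> \<noteq> 0))"
      using \<beta>hat_AE by eventually_elim (simp add: supp_def of_bool_def sum.If_cases)
  qed measurable
  also have "\<dots> = (\<Sum>j\<in>UNIV. \<integral>\<omega>. of_bool (b j \<omega> \<noteq> 0) \<partial>M)"
    by (intro Bochner_Integration.integral_sum integrable_const_bound[where B = 1]) auto
  finally show ?thesis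
    using df by (simp add: t_def m_def)
qed

end
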